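(* Let $G$ be a connected bipartite graph on $n\geq 3$ vertices. If $G$ has no suspended paths, then $$RE(G)\leq \sqrt{n-2}\,\sqrt{n-4}\,\frac{\sqrt{2}}{2}+2.$$
   Context: Graphs are finite, simple and undirected. For a graph $G$ with vertex set $V$, edge set $E$ and vertex degrees $d_u$, the Randić matrix $R=[r_{uv}]$ is the real symmetric matrix indexed by $V$ with $r_{uv}=1/\sqrt{d_ud_v}$ if $uv\in E$ and $r_{uv}=0$ otherwise. The Randić energy is $RE(G)=\sum_{i=1}^n|\lambda_i|$, where $\lambda_1,\dots,\lambda_n$ are the eigenvalues of $R$ with multiplicity. A suspended path is a path $uvw$ in $G$ with $d_u=1$ and $d_v=2$ (i.e. $u$ is a pendent vertex whose neighbor has degree $2$). *)

theory Defs
  imports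
    "HOL-Computational_Algebra.Polynomial"
    "Jordan_Normal_Form.Char_Poly"
    "Graph_Theory.Digraph_Component"
begin

text \<open>
  A finite simple undirected graph is a \<^locale>\<open>pair_graph\<close>, i.e. a finite loop-free digraph
  whose arcs are pairs of vertices and form a symmetric relation; the edge \<open>uv\<close> corresponds to
  the two arcs \<open>(u, v)\<close> and \<open>(v, u)\<close>.  Hence the degree of a vertex is its out-degree.
\<close>

abbreviation vdegree :: "'a pair_pre_digraph \<Rightarrow> 'a \<Rightarrow> nat" where
  "vdegree G v \<equiv> out_degree (with_proj G) v"

definition bipartite :: "'a pair_pre_digraph \<Rightarrow> bool" where
  "bipartite G \<longleftrightarrow> (\<exists>X Y. pverts G = X \<union> Y \<and> X \<inter> Y = {} \<and>
     (\<forall>(u, v) \<in> parcs G. u \<in> X \<and> v \<in> Y \<or> u \<in> Y \<and> v \<in> X))"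

definition suspended_path :: "'a pair_pre_digraph \<Rightarrow> 'a \<Rightarrow> 'a \<Rightarrow> 'a \<Rightarrow> bool" where
  "suspended_path G u v w \<longleftrightarrow> distinct [u, v, w] \<and> (u, v) \<in> parcs G \<and> (v, w) \<in> parcs G \<and>
     vdegree G u = 1 \<and> vdegree G v = 2"

definition randic_weight :: "'a pair_pre_digraph \<Rightarrow> 'a \<Rightarrow> 'a \<Rightarrow> real" where
  "randic_weight G u v =
     (if (u, v) \<in> parcs G then 1 / sqrt (real (vdegree G u) * real (vdegree G v)) else 0)"

text \<open>
  Matrices are indexed by initial segments of the natural numbers, so the Randic matrix is taken
  with respect to a list \<open>vs\<close> enumerating the vertices.  The choice of the enumeration in the energy
  is immaterial, see \<open>randic_energy_eq\<close> below.
\<close>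

definition randic_matrix :: "'a pair_pre_digraph \<Rightarrow> 'a list \<Rightarrow> real mat" where
  "randic_matrix G vs =
     mat (length vs) (length vs) (\<lambda>(i, j). randic_weight G (vs ! i) (vs ! j))"

text \<open>
  The multiset of real roots of the characteristic polynomial contains all eigenvalues with
  multiplicity, as the matrix is real symmetric.
\<close>

definition randic_energy :: "'a pair_pre_digraph \<Rightarrow> real" where
  "randic_energy G =
     (let vs = (SOME vs. distinct vs \<and> set vs = pverts G)
      in \<Sum>x\<in>#proots (char_poly (randic_matrix G vs)). \<bar>x\<bar>)"

lemma mat_mult_enumerated:
  fixes f g :: "'a \<Rightarrow> 'a \<Rightarrow> 'b :: comm_ring_1"
  assumes "distinct vs" "set vs = V" "length us = n" "length vs = n" "length ws = n"
  shows "mat n n (\<lambda>(i, j). f (us ! i) (vs ! j)) * mat n n (\<lambda>(i, j). g (vs ! i) (ws ! j)) =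
    mat n n (\<lambda>(i, j). \<Sum>z\<in>V. f (us ! i) z * g z (ws ! j))"
proof -
  have bij: "bij_betw (\<lambda>k. vs ! k) {0..<n} V"
    using assms bij_betw_nth[of vs "{0..<n}" V] by (auto simp: atLeast0LessThan)
  show ?thesis
    by (rule eq_matI)
      (auto simp: scalar_prod_def sum.reindex_bij_betw[OF bij, symmetric])
qed

lemma char_poly_enumerated:
  fixes f :: "'a \<Rightarrow> 'a \<Rightarrow> 'b :: comm_ring_1"
  assumes "distinct vs" "set vs = V" "distinct ws" "set ws = V"
  shows "char_poly (mat (length vs) (length vs) (\<lambda>(i, j). f (vs ! i) (vs ! j))) =
    char_poly (mat (length ws) (length ws) (\<lambda>(i, j). f (ws ! i) (ws ! j)))"
proof -
  define n where "n = card V"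
  have len: "length vs = n" "length ws = n"
    using assms distinct_card n_def by metis+
  have fin: "finite V"
    using assms by auto
  let ?d = "\<lambda>x y :: 'a. if x = y then 1 else 0 :: 'b"
  let ?M = "\<lambda>f us ws. mat n n (\<lambda>(i, j). f (us ! i) (ws ! j)) :: 'b mat"
  have delta: "(if P then 1 else 0) * a = (if P then a else 0)"
    "a * (if P then 1 else 0) = (if P then a else 0)" for P and a :: 'b
    by auto
  have one: "?M ?d us xs * ?M ?d xs us = 1\<^sub>m n"
    if "distinct us" "set us = V" "length us = n" "distinct xs" "set xs = V" "length xs = n" for us xs
    using that fin
    by (subst mat_mult_enumerated[where V = V])
      (auto intro!: eq_matI simp: delta nth_eq_iff_index_eq)
  have "?M ?d vs ws * ?M f ws ws = ?M f vs ws"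
    using assms len fin
    by (subst mat_mult_enumerated[where V = V]) (auto intro!: eq_matI simp: delta)
  moreover have "?M f vs ws * ?M ?d ws vs = ?M f vs vs"
    using assms len fin
    by (subst mat_mult_enumerated[where V = V]) (auto intro!: eq_matI simp: delta)
  ultimately have "?M f vs vs = ?M ?d vs ws * ?M f ws ws * ?M ?d ws vs"
    by simp
  then have "similar_mat (?M f vs vs) (?M f ws ws)"
    using one[of vs ws] one[of ws vs] assms len
    by (intro similar_matI[where P = "?M ?d vs ws" and Q = "?M ?d ws vs" and n = n]) auto
  then show ?thesis
    using len char_poly_similar by simp
qed

lemma randic_energy_eq:
  assumes "distinct vs" "set vs = pverts G"
  shows "randic_energy G = (\<Sum>x\<in>#proots (char_poly (randic_matrix G vs)). \<bar>x\<bar>)"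
proof -
  define us where "us = (SOME us. distinct us \<and> set us = pverts G)"
  have "distinct us \<and> set us = pverts G"
    unfolding us_def by (rule someI[of _ vs]) (use assms in auto)
  then have "char_poly (randic_matrix G us) = char_poly (randic_matrix G vs)"
    unfolding randic_matrix_def using assms by (intro char_poly_enumerated) auto
  then show ?thesis
    by (simp add: randic_energy_def Let_def flip: us_def)
qed

end

theory Submission
  imports Defs "Jordan_Normal_Form.Schur_Decomposition" "HOL-Analysis.Convex"
begin

text \<open>
  The argument combines a spectral estimate with a local estimate on edges.

  The vector with entries \<open>sqrt (d v)\<close> is an eigenvector of the Randic matrix \<open>R\<close> for the
  eigenvalue 1, and changing its sign on one side of the bipartition gives an eigenvector for -1.
  These two contribute 2 to the energy.  The remaining \<open>n - 2\<close> eigenvalues have squares summing to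
  \<open>tr (R\<^sup>2) - 2\<close>, so by Cauchy-Schwarz the energy is at most
  \<open>2 + sqrt ((n - 2) * (tr (R\<^sup>2) - 2))\<close>; this is \<open>symmetric_mat_energy_le\<close>.

  It remains to show \<open>tr (R\<^sup>2) \<le> n / 2\<close>, where \<open>tr (R\<^sup>2)\<close> is the sum of \<open>1 / (d u * d v)\<close> over all
  arcs \<open>(u, v)\<close>.  On an edge with \<open>d u + d v \<ge> 4\<close> this summand is at most
  \<open>1 / (4 * d u) + 1 / (4 * d v)\<close>.  Summed over the \<open>d u\<close> arcs leaving \<open>u\<close>, the term
  \<open>1 / (4 * d u)\<close> gives \<open>1 / 4\<close>, so the whole sum is at most \<open>n / 2\<close>
  (\<open>sum_randic_weight_squared_le\<close>).  An edge with \<open>d u + d v \<le> 3\<close> has degrees 1 and 1, which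
  makes it a whole component, or 1 and 2, which makes it the start of a suspended path; both are
  excluded (\<open>connected_degree_sum_ge_4\<close>).
\<close>

section \<open>Eigenvalues of real symmetric matrices\<close>

text \<open>
  For an eigenvector \<open>v\<close>, the Hermitian form \<open>v\<^sup>* A v\<close> is its own conjugate because \<open>A\<close> is real and
  symmetric, and it equals \<open>a\<close> times the positive real number \<open>v\<^sup>* v\<close>.
\<close>

lemma symmetric_mat_eigenvalue_Reals:
  fixes A :: "real mat"
  assumes A: "A \<in> carrier_mat n n"
    and sym: "transpose_mat A = A"
    and ev: "eigenvalue (map_mat complex_of_real A) a"
  shows "a \<in> \<real>"
proof -
  let ?A = "map_mat complex_of_real A"
  obtain v where v: "v \<in> carrier_vec n" "v \<noteq> 0\<^sub>v n" "?A *\<^sub>v v = a \<cdot>\<^sub>v v"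
    using ev A unfolding eigenvalue_def eigenvector_def by auto
  have A_sym: "A $$ (i, j) = A $$ (j, i)" if "i < n" "j < n" for i j
    using sym A that by (metis carrier_matD index_transpose_mat(1))
  have row: "(\<Sum>j<n. complex_of_real (A $$ (i, j)) * v $ j) = a * v $ i" if "i < n" for i
  proof -
    have "(?A *\<^sub>v v) $ i = (\<Sum>j<n. complex_of_real (A $$ (i, j)) * v $ j)"
      using that A v(1) by (simp add: scalar_prod_def atLeast0LessThan)
    then show ?thesis
      using v that by simp
  qed
  define q where "q = (\<Sum>i<n. \<Sum>j<n. cnj (v $ i) * complex_of_real (A $$ (i, j)) * v $ j)"
  define r where "r = (\<Sum>i<n. (cmod (v $ i))\<^sup>2)"
  have "q = (\<Sum>i<n. cnj (v $ i) * (\<Sum>j<n. complex_of_real (A $$ (i, j)) * v $ j))"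
    by (simp add: q_def sum_distrib_left mult.assoc)
  also have "\<dots> = (\<Sum>i<n. cnj (v $ i) * (a * v $ i))"
    by (simp add: row)
  also have "\<dots> = a * complex_of_real r"
    by (simp add: r_def sum_distrib_left complex_norm_square mult_ac del: of_real_power)
  finally have q: "q = a * complex_of_real r" .
  have "cnj q = (\<Sum>i<n. \<Sum>j<n. cnj (v $ j) * complex_of_real (A $$ (i, j)) * v $ i)"
    by (simp add: q_def mult_ac)
  also have "\<dots> = q"
    unfolding q_def by (subst sum.swap) (auto intro!: sum.cong simp: A_sym)
  finally have "q \<in> \<real>"
    by (simp add: Reals_cnj_iff)
  obtain i where "i < n" "v $ i \<noteq> 0"
    using v by (metis carrier_vecD eq_vecI index_zero_vec(1) index_zero_vec(2))
  then have "r > 0"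
    unfolding r_def by (intro sum_pos2[where i = i]) auto
  then have "a = q / complex_of_real r"
    by (simp add: q)
  with \<open>q \<in> \<real>\<close> show ?thesis
    by simp
qed

text \<open>
  The factorization exists over the complex numbers; as all roots are real, it descends to the reals.
  This accounts for all eigenvalues by real roots and is what Schur decomposition over the reals
  needs as input.
\<close>

lemma symmetric_mat_char_poly_splits:
  fixes A :: "real mat"
  assumes A: "A \<in> carrier_mat n n" and sym: "transpose_mat A = A"
  obtains es where "char_poly A = (\<Prod>e\<leftarrow>es. [:- e, 1:])" "length es = n"
proof -
  let ?A = "map_mat complex_of_real A"
  have cA: "?A \<in> carrier_mat n n"
    using A by simp
  obtain as where as: "char_poly ?A = (\<Prod>a\<leftarrow>as. [:- a, 1:])" "length as = n"
    using char_poly_factorized[OF cA] by blast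
  have real: "complex_of_real (Re a) = a" if "a \<in> set as" for a
  proof -
    have "poly (char_poly ?A) a = 0"
      using that by (auto simp: as poly_prod_list prod_list_zero_iff)
    then show ?thesis
      using symmetric_mat_eigenvalue_Reals[OF A sym, of a] eigenvalue_root_char_poly[OF cA]
      by simp
  qed
  interpret of_real_poly: map_poly_inj_comm_ring_hom complex_of_real ..
  have "map_poly complex_of_real (char_poly A) = (\<Prod>a\<leftarrow>as. [:- a, 1:])"
    using of_real_hom.char_poly_hom[OF A, where ?'a = complex] as by simp
  also have "\<dots> = (\<Prod>a\<leftarrow>as. map_poly complex_of_real [:- Re a, 1:])"
    by (intro arg_cong[where f = prod_list] map_cong) (auto simp: real)
  also have "\<dots> = map_poly complex_of_real (\<Prod>e\<leftarrow>map Re as. [:- e, 1:])"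
    by (simp add: of_real_poly.hom_prod_list o_def)
  finally have "char_poly A = (\<Prod>e\<leftarrow>map Re as. [:- e, 1:])"
    by simp
  then show ?thesis
    using as(2) by (intro that[of "map Re as"]) simp_all
qed

lemma proots_prod_linear_factors:
  fixes es :: "'a :: idom list"
  shows "proots (\<Prod>e\<leftarrow>es. [:- e, 1:]) = mset es"
proof -
  have "0 \<notin> set (map (\<lambda>e. [:- e, 1:]) es)"
    by auto
  then have "proots (\<Prod>e\<leftarrow>es. [:- e, 1:]) = (\<Sum>p\<leftarrow>map (\<lambda>e. [:- e, 1:]) es. proots p)"
    using proots_prod_list[of "map (\<lambda>e. [:- e, 1:]) es"] by simp
  also have "\<dots> = mset es"
    by (induction es) simp_all
  finally show ?thesis .
qed

text \<open>
  The trace of a matrix is written as \<open>sum_list (diag_mat A)\<close>.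
\<close>

lemma sum_list_diag_mat_mult_commute:
  fixes A B :: "'a :: comm_semiring_0 mat"
  assumes "A \<in> carrier_mat n m" "B \<in> carrier_mat m n"
  shows "sum_list (diag_mat (A * B)) = sum_list (diag_mat (B * A))"
proof -
  have "sum_list (diag_mat (A * B)) = (\<Sum>i<n. \<Sum>j<m. A $$ (i, j) * B $$ (j, i))"
    using assms
    by (simp add: diag_mat_def scalar_prod_def sum_list_distinct_conv_sum_set atLeast0LessThan)
  also have "\<dots> = (\<Sum>j<m. \<Sum>i<n. B $$ (j, i) * A $$ (i, j))"
    by (subst sum.swap) (simp add: mult.commute)
  also have "\<dots> = sum_list (diag_mat (B * A))"
    using assms
    by (simp add: diag_mat_def scalar_prod_def sum_list_distinct_conv_sum_set atLeast0LessThan)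
  finally show ?thesis .
qed

lemma sum_list_diag_mat_similar:
  assumes "similar_mat_wit A B P Q"
  shows "sum_list (diag_mat A) = sum_list (diag_mat (B :: 'a :: comm_ring_1 mat))"
proof -
  define n where "n = dim_row A"
  note w = similar_mat_witD[OF n_def assms]
  have "sum_list (diag_mat A) = sum_list (diag_mat (P * (B * Q)))"
    using w by (simp add: assoc_mult_mat[of P n n B n Q n])
  also have "\<dots> = sum_list (diag_mat (B * Q * P))"
    using w by (intro sum_list_diag_mat_mult_commute[of _ n n]) auto
  also have "B * Q * P = B"
    using w by (simp add: assoc_mult_mat[of B n n Q n P n])
  finally show ?thesis .
qed

lemma diag_mat_mult_upper_triangular:
  fixes B :: "'a :: semiring_0 mat"
  assumes B: "B \<in> carrier_mat n n" "upper_triangular B"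
  shows "diag_mat (B * B) = map (\<lambda>x. x * x) (diag_mat B)"
proof -
  have "(B * B) $$ (i, i) = B $$ (i, i) * B $$ (i, i)" if "i < n" for i
  proof -
    have "(B * B) $$ (i, i) = (\<Sum>j<n. B $$ (i, j) * B $$ (j, i))"
      using that B(1) by (simp add: scalar_prod_def atLeast0LessThan)
    also have "\<dots> = (\<Sum>j<n. if j = i then B $$ (i, i) * B $$ (i, i) else 0)"
    proof (intro sum.cong refl)
      fix j assume "j \<in> {..<n}"
      then show "B $$ (i, j) * B $$ (j, i) = (if j = i then B $$ (i, i) * B $$ (i, i) else 0)"
        using upper_triangularD[OF B(2), of j i] upper_triangularD[OF B(2), of i j] that B(1)
        by (cases i j rule: linorder_cases) auto
    qed
    also have "\<dots> = B $$ (i, i) * B $$ (i, i)"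
      using that by simp
    finally show ?thesis .
  qed
  then show ?thesis
    using B(1) by (auto simp: diag_mat_def)
qed

text \<open>
  Both sides are the trace of \<open>A\<^sup>2\<close>: the right one by symmetry, the left one because \<open>A\<close> is similar
  to an upper triangular matrix with the eigenvalues on the diagonal.
\<close>

lemma symmetric_mat_sum_square_eigenvalues:
  fixes A :: "real mat"
  assumes A: "A \<in> carrier_mat n n" and sym: "transpose_mat A = A"
  shows "(\<Sum>x\<in>#proots (char_poly A). x\<^sup>2) = (\<Sum>i<n. \<Sum>j<n. (A $$ (i, j))\<^sup>2)"
proof -
  obtain es where es: "char_poly A = (\<Prod>e\<leftarrow>es. [:- e, 1:])"
    using symmetric_mat_char_poly_splits[OF A sym] by blast
  obtain B P Q where "schur_decomposition A es = (B, P, Q)"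
    by (cases "schur_decomposition A es")
  from schur_decomposition[OF A es this]
  have wit: "similar_mat_wit A B P Q" and B: "upper_triangular B" "diag_mat B = es"
    by auto
  have cB: "B \<in> carrier_mat n n"
    using similar_mat_witD2[OF A wit] by simp
  have "similar_mat_wit (A * A) (B * B) P Q"
    using similar_mat_wit_pow[OF wit, of 2] A cB by (simp add: numeral_2_eq_2)
  then have "sum_list (diag_mat (A * A)) = (\<Sum>e\<leftarrow>es. e * e)"
    using sum_list_diag_mat_similar diag_mat_mult_upper_triangular[OF cB B(1)] B(2) by metis
  moreover have "sum_list (diag_mat (A * A)) = (\<Sum>i<n. \<Sum>j<n. A $$ (i, j) * A $$ (j, i))"
    using A
    by (simp add: diag_mat_def scalar_prod_def sum_list_distinct_conv_sum_set atLeast0LessThan)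
  moreover have "A $$ (j, i) = A $$ (i, j)" if "i < n" "j < n" for i j
    using sym A that by (metis carrier_matD index_transpose_mat(1))
  ultimately have "(\<Sum>e\<leftarrow>es. e\<^sup>2) = (\<Sum>i<n. \<Sum>j<n. (A $$ (i, j))\<^sup>2)"
    by (simp add: power2_eq_square)
  then show ?thesis
    unfolding es proots_prod_linear_factors mset_map[symmetric] sum_mset_sum_list .
qed

lemma sum_mset_abs_le_sqrt:
  fixes M :: "real multiset"
  shows "(\<Sum>x\<in>#M. \<bar>x\<bar>) \<le> sqrt (real (size M) * (\<Sum>x\<in>#M. x\<^sup>2))"
proof -
  obtain xs where M: "M = mset xs"
    by (metis ex_mset)
  have nth: "(\<Sum>x\<in>#M. f x) = (\<Sum>i<length xs. f (xs ! i))" for f :: "real \<Rightarrow> real"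
    unfolding M mset_map[symmetric] sum_mset_sum_list
    by (simp add: sum_list_sum_nth atLeast0LessThan)
  have "(\<Sum>x\<in>#M. \<bar>x\<bar>)\<^sup>2 \<le> (\<Sum>x\<in>#M. x\<^sup>2) * real (size M)"
    using sum_squared_le_sum_of_squares[of "\<lambda>i. \<bar>xs ! i\<bar>" "{..<length xs}"]
    unfolding nth by (simp add: M)
  then show ?thesis
    by (simp add: mult.commute real_le_rsqrt)
qed

text \<open>
  The two known eigenvalues are split off before Cauchy-Schwarz is applied; applying it to all \<open>n\<close>
  eigenvalues would only give the weaker bound \<open>sqrt (n * tr (A\<^sup>2))\<close>.
\<close>

lemma symmetric_mat_energy_le:
  fixes A :: "real mat"
  assumes A: "A \<in> carrier_mat n n" and sym: "transpose_mat A = A"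
    and ev: "eigenvalue A 1" "eigenvalue A (- 1)"
  shows "(\<Sum>x\<in>#proots (char_poly A). \<bar>x\<bar>) \<le>
    2 + sqrt ((real n - 2) * ((\<Sum>i<n. \<Sum>j<n. (A $$ (i, j))\<^sup>2) - 2))"
proof -
  let ?p = "char_poly A"
  have "?p \<noteq> 0"
    using degree_monic_char_poly[OF A] by auto
  obtain es where es: "?p = (\<Prod>e\<leftarrow>es. [:- e, 1:])" "length es = n"
    using symmetric_mat_char_poly_splits[OF A sym] by blast
  have size: "size (proots ?p) = n"
    using es by (simp add: proots_prod_linear_factors)
  have roots: "1 \<in># proots ?p" "- 1 \<in># proots ?p"
    using ev \<open>?p \<noteq> 0\<close> by (simp_all add: eigenvalue_root_char_poly[OF A])
  obtain N where N: "proots ?p = add_mset 1 N"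
    using roots(1) by (metis insert_DiffM)
  then have "- 1 \<in># N"
    using roots(2) by simp
  then obtain M where "N = add_mset (- 1) M"
    by (metis insert_DiffM)
  with N have M: "proots ?p = add_mset 1 (add_mset (- 1) M)"
    by simp
  have "real (size M) = real n - 2"
    using size unfolding M by simp
  moreover have "(\<Sum>x\<in>#M. x\<^sup>2) = (\<Sum>i<n. \<Sum>j<n. (A $$ (i, j))\<^sup>2) - 2"
    using symmetric_mat_sum_square_eigenvalues[OF A sym] unfolding M by simp
  ultimately show ?thesis
    using sum_mset_abs_le_sqrt[of M] unfolding M by simp
qed

section \<open>The Randic matrix\<close>

lemma sum_nth_enumeration:
  assumes "distinct vs"
  shows "(\<Sum>i<length vs. f (vs ! i)) = (\<Sum>v\<in>set vs. f v)"
  using assms sum.reindex_bij_betw[OF bij_betw_nth[OF assms refl refl], of f] by simp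

lemma randic_matrix_carrier [simp]:
  "randic_matrix G vs \<in> carrier_mat (length vs) (length vs)"
  by (simp add: randic_matrix_def)

lemma randic_matrix_nth [simp]:
  assumes "i < length vs" "j < length vs"
  shows "randic_matrix G vs $$ (i, j) = randic_weight G (vs ! i) (vs ! j)"
  using assms by (simp add: randic_matrix_def)

lemma randic_matrix_eigenvalueI:
  assumes vs: "distinct vs" "set vs = pverts G"
    and eq: "\<And>u. u \<in> pverts G \<Longrightarrow> (\<Sum>v\<in>pverts G. randic_weight G u v * x v) = c * x u"
    and nonzero: "u \<in> pverts G" "x u \<noteq> 0"
  shows "eigenvalue (randic_matrix G vs) c"
proof -
  let ?x = "vec (length vs) (\<lambda>i. x (vs ! i))"
  obtain i where "i < length vs" "vs ! i = u"
    using nonzero(1) vs(2) by (metis in_set_conv_nth)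
  then have "?x \<noteq> 0\<^sub>v (length vs)"
    using nonzero(2) by (metis index_vec index_zero_vec(1))
  moreover have "randic_matrix G vs *\<^sub>v ?x = c \<cdot>\<^sub>v ?x"
  proof (rule eq_vecI)
    fix i assume "i < dim_vec (c \<cdot>\<^sub>v ?x)"
    then have i: "i < length vs"
      by simp
    then have "(randic_matrix G vs *\<^sub>v ?x) $ i =
        (\<Sum>j<length vs. randic_weight G (vs ! i) (vs ! j) * x (vs ! j))"
      by (simp add: scalar_prod_def atLeast0LessThan randic_matrix_def)
    also have "\<dots> = c * x (vs ! i)"
      using sum_nth_enumeration[OF vs(1), of "\<lambda>v. randic_weight G (vs ! i) v * x v"]
        eq[of "vs ! i"] i vs(2) nth_mem by auto
    finally show "(randic_matrix G vs *\<^sub>v ?x) $ i = (c \<cdot>\<^sub>v ?x) $ i"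
      using i by simp
  qed (simp add: randic_matrix_def)
  ultimately show ?thesis
    unfolding eigenvalue_def eigenvector_def by (intro exI[of _ ?x]) (simp add: randic_matrix_def)
qed

context pair_graph
begin

lemma vdegree_eq_card: "vdegree G u = card {v \<in> pverts G. (u, v) \<in> parcs G}"
proof -
  have "out_arcs (with_proj G) u = Pair u ` {v \<in> pverts G. (u, v) \<in> parcs G}"
    by (auto simp: out_arcs_def in_arcsD2)
  then show ?thesis
    by (simp add: out_degree_def card_image inj_on_def)
qed

lemma sum_arcs_const:
  "(\<Sum>v\<in>pverts G. if (u, v) \<in> parcs G then c else 0) = real (vdegree G u) * c"
  by (simp add: vdegree_eq_card pair_finite_verts flip: sum.inter_filter)

lemma randic_weight_commute: "randic_weight G u v = randic_weight G v u"
  using arcs_symmetric by (auto simp: randic_weight_def mult.commute)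

lemma transpose_randic_matrix: "transpose_mat (randic_matrix G vs) = randic_matrix G vs"
  by (rule eq_matI) (auto simp: randic_matrix_def randic_weight_commute)

text \<open>
  Eigenvectors of the form \<open>s v * sqrt (d v)\<close>: the weight cancels \<open>sqrt (d v)\<close>, and each of the \<open>d u\<close>
  neighbours of \<open>u\<close> contributes \<open>c * s u / sqrt (d u)\<close>.  With \<open>s = 1\<close> this gives the eigenvalue 1;
  with \<open>s\<close> the sign given by a bipartition it gives -1.
\<close>

lemma randic_weight_sqrt_degree:
  assumes pos: "\<And>v. v \<in> pverts G \<Longrightarrow> vdegree G v > 0"
    and s: "\<And>v. (u, v) \<in> parcs G \<Longrightarrow> s v = c * s u"
    and u: "u \<in> pverts G"
  shows "(\<Sum>v\<in>pverts G. randic_weight G u v * (s v * sqrt (vdegree G v))) =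
    c * (s u * sqrt (vdegree G u))"
proof -
  have "(\<Sum>v\<in>pverts G. randic_weight G u v * (s v * sqrt (vdegree G v))) =
      (\<Sum>v\<in>pverts G. if (u, v) \<in> parcs G then c * s u / sqrt (vdegree G u) else 0)"
    using pos by (intro sum.cong) (auto simp: randic_weight_def s real_sqrt_mult)
  also have "\<dots> = real (vdegree G u) * (c * s u / sqrt (vdegree G u))"
    by (rule sum_arcs_const)
  also have "\<dots> = c * s u * (real (vdegree G u) / sqrt (vdegree G u))"
    by simp
  also have "\<dots> = c * (s u * sqrt (vdegree G u))"
    by (simp add: real_div_sqrt)
  finally show ?thesis .
qed

text \<open>
  After multiplication by \<open>4 * d u * d v\<close>, the degree condition is exactly the inequality
  \<open>1 / (d u * d v) \<le> 1 / (4 * d u) + 1 / (4 * d v)\<close>.  The right-hand side distributes each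
  summand to the two ends of its arc, and every vertex receives \<open>1 / 4\<close> as a tail and \<open>1 / 4\<close> as a
  head.
\<close>

lemma sum_randic_weight_squared_le:
  assumes pos: "\<And>v. v \<in> pverts G \<Longrightarrow> vdegree G v > 0"
    and ge4: "\<And>u v. (u, v) \<in> parcs G \<Longrightarrow> vdegree G u + vdegree G v \<ge> 4"
  shows "(\<Sum>u\<in>pverts G. \<Sum>v\<in>pverts G. (randic_weight G u v)\<^sup>2) \<le> real (card (pverts G)) / 2"
proof -
  let ?h = "\<lambda>u v. if (u, v) \<in> parcs G then 1 / (4 * real (vdegree G u)) else 0"
  have "(randic_weight G u v)\<^sup>2 \<le> ?h u v + ?h v u" for u v
  proof (cases "(u, v) \<in> parcs G")
    case True
    then have "real (vdegree G u) > 0" "real (vdegree G v) > 0"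
      "real (vdegree G u) + real (vdegree G v) \<ge> 4"
      using pos in_arcsD1 in_arcsD2 ge4[OF True] by (auto simp flip: of_nat_add)
    then show ?thesis
      using True arcs_symmetric[OF True]
      by (simp add: randic_weight_def power_divide field_simps)
  next
    case False
    then show ?thesis
      by (simp add: randic_weight_def)
  qed
  then have "(\<Sum>u\<in>pverts G. \<Sum>v\<in>pverts G. (randic_weight G u v)\<^sup>2) \<le>
      (\<Sum>u\<in>pverts G. \<Sum>v\<in>pverts G. ?h u v + ?h v u)"
    by (intro sum_mono)
  also have "\<dots> = 2 * (\<Sum>u\<in>pverts G. \<Sum>v\<in>pverts G. ?h u v)"
    using sum.swap[of "\<lambda>u v. ?h v u" "pverts G" "pverts G"] by (simp add: sum.distrib)
  also have "(\<Sum>u\<in>pverts G. \<Sum>v\<in>pverts G. ?h u v) = (\<Sum>u\<in>pverts G. 1 / 4)"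
    using pos by (intro sum.cong refl, subst sum_arcs_const) auto
  finally show ?thesis
    by simp
qed

section \<open>Degrees in connected graphs without suspended paths\<close>

text \<open>
  Connectivity enters only in this form, for sets \<open>S\<close> of one or two vertices: a proper such set cannot
  be closed under taking neighbours.
\<close>

lemma connected_closed_set_eq_verts:
  assumes con: "Digraph_Component.connected (with_proj G)"
    and S: "S \<subseteq> pverts G" "u \<in> S"
    and closed: "\<And>x y. x \<in> S \<Longrightarrow> (x, y) \<in> parcs G \<Longrightarrow> y \<in> S"
  shows "S = pverts G"
proof
  show "pverts G \<subseteq> S"
  proof
    fix v assume "v \<in> pverts G"
    then have "u \<rightarrow>\<^sup>*\<^bsub>with_proj G\<^esub> v"
      using con S reachable_mk_symmetric_eq[OF pair_sym_arcs, of u v]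
      by (auto simp: Digraph_Component.connected_def strongly_connected_def)
    then show "v \<in> S"
      by (induction rule: reachable_induct) (auto intro: S(2) closed)
  qed
qed (rule S(1))

lemma connected_degree_pos:
  assumes con: "Digraph_Component.connected (with_proj G)" and "card (pverts G) \<ge> 2"
    and "u \<in> pverts G"
  shows "vdegree G u > 0"
proof (rule ccontr)
  assume "\<not> vdegree G u > 0"
  then have "(u, v) \<notin> parcs G" for v
    using in_arcsD2 by (auto simp: vdegree_eq_card pair_finite_verts)
  then have "{u} = pverts G"
    using assms(3) by (intro connected_closed_set_eq_verts[OF con, of _ u]) auto
  then have "card (pverts G) = 1"
    by (metis card_1_singleton_iff One_nat_def)
  with assms(2) show False
    by simp
qed

lemma degree_one_neighbour_unique:
  assumes "vdegree G u = 1" "(u, v) \<in> parcs G" "(u, w) \<in> parcs G"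
  shows "w = v"
proof -
  obtain z where "{x \<in> pverts G. (u, x) \<in> parcs G} = {z}"
    using assms(1) unfolding vdegree_eq_card by (rule card_1_singletonE)
  moreover have "v \<in> {x \<in> pverts G. (u, x) \<in> parcs G}" "w \<in> {x \<in> pverts G. (u, x) \<in> parcs G}"
    using assms in_arcsD2 by auto
  ultimately show ?thesis
    by simp
qed

text \<open>
  It is enough that the neighbour \<open>y\<close> of a pendent vertex \<open>x\<close> has degree at least 3.  If \<open>y\<close> had degree
  1, then \<open>{x, y}\<close> would be all of the graph; if it had degree 2, its other neighbour would
  complete a suspended path.
\<close>

lemma connected_degree_sum_ge_4:
  assumes con: "Digraph_Component.connected (with_proj G)" and card: "card (pverts G) \<ge> 3"
    and no_susp: "\<not> (\<exists>u v w. suspended_path G u v w)"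
    and arc: "(u, v) \<in> parcs G"
  shows "vdegree G u + vdegree G v \<ge> 4"
proof -
  have pendent: "vdegree G y \<ge> 3" if "(x, y) \<in> parcs G" "vdegree G x = 1" for x y
  proof -
    have yx: "(y, x) \<in> parcs G" and verts: "x \<in> pverts G" "y \<in> pverts G"
      using that arcs_symmetric in_arcsD1 in_arcsD2 by auto
    have "vdegree G y > 0"
      using connected_degree_pos[OF con _ verts(2)] card by simp
    moreover have "vdegree G y \<noteq> 1"
    proof
      assume "vdegree G y = 1"
      then have "{x, y} = pverts G"
        using degree_one_neighbour_unique that yx verts
        by (intro connected_closed_set_eq_verts[OF con, of _ x]) blast+
      moreover have "card {x, y} \<le> 2"
        by (simp add: card_insert_if)
      ultimately show False
        using card by simp
    qed
    moreover have "vdegree G y \<noteq> 2"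
    proof
      assume deg: "vdegree G y = 2"
      have "\<not> {v \<in> pverts G. (y, v) \<in> parcs G} \<subseteq> {x}"
        using card_mono[of "{x}" "{v \<in> pverts G. (y, v) \<in> parcs G}"] deg
        by (auto simp: vdegree_eq_card)
      then obtain w where "w \<noteq> x" "(y, w) \<in> parcs G"
        by blast
      then have "suspended_path G x y w"
        using that deg no_loops' by (auto simp: suspended_path_def)
      with no_susp show False
        by blast
    qed
    ultimately show ?thesis
      by linarith
  qed
  have "vdegree G u > 0" "vdegree G v > 0"
    using connected_degree_pos[OF con] card in_arcsD1[OF arc] in_arcsD2[OF arc] by auto
  then show ?thesis
    using pendent[OF arc] pendent[OF arcs_symmetric[OF arc]] by linarith
qed

end

section \<open>The energy bound\<close>

theorem theorem4p7:
  fixes G :: "'a pair_pre_digraph" and n :: nat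
  assumes "pair_graph G"
    and "Digraph_Component.connected (with_proj G)"
    and "bipartite G"
    and "card (pverts G) = n"
    and "n \<ge> 3"
    and "\<not> (\<exists>u v w. suspended_path G u v w)"
  shows "randic_energy G \<le> sqrt (real n - 2) * sqrt (real n - 4) * (sqrt 2 / 2) + 2"
proof -
  interpret pair_graph G by fact
  have pos: "vdegree G v > 0" if "v \<in> pverts G" for v
    using connected_degree_pos[OF assms(2) _ that] assms(4,5) by simp
  obtain vs where vs: "distinct vs" "set vs = pverts G"
    using finite_distinct_list[OF pair_finite_verts] by blast
  then have len: "length vs = n"
    using assms(4) distinct_card by metis
  let ?R = "randic_matrix G vs"
  have R: "?R \<in> carrier_mat n n"
    using len randic_matrix_carrier[of G vs] by simp
  obtain u where u: "u \<in> pverts G"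
    using assms(4,5) by (metis card.empty equals0I not_numeral_le_zero)
  obtain X Y where XY: "X \<inter> Y = {}" "\<forall>(u, v) \<in> parcs G. u \<in> X \<and> v \<in> Y \<or> u \<in> Y \<and> v \<in> X"
    using assms(3) unfolding bipartite_def by blast
  define s :: "'a \<Rightarrow> real" where "s v = (if v \<in> X then 1 else - 1)" for v
  have s: "s v = - 1 * s u" if "(u, v) \<in> parcs G" for u v
    using XY that by (auto simp: s_def)
  have "s u \<noteq> 0" for u
    by (simp add: s_def)
  have ev: "eigenvalue ?R 1" "eigenvalue ?R (- 1)"
    using randic_matrix_eigenvalueI[OF vs randic_weight_sqrt_degree[OF pos, of _ "\<lambda>_. 1" 1] u]
      randic_matrix_eigenvalueI[OF vs randic_weight_sqrt_degree[OF pos s] u] pos[OF u] \<open>s u \<noteq> 0\<close>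
    by simp_all
  let ?F = "\<Sum>i<n. \<Sum>j<n. (?R $$ (i, j))\<^sup>2"
  have "?F = (\<Sum>i<length vs. \<Sum>j<length vs. (randic_weight G (vs ! i) (vs ! j))\<^sup>2)"
    by (simp add: len)
  also have "\<dots> = (\<Sum>u\<in>pverts G. \<Sum>v\<in>pverts G. (randic_weight G u v)\<^sup>2)"
    by (simp add: sum_nth_enumeration[OF vs(1), where f = "\<lambda>v. (randic_weight G _ v)\<^sup>2"]
        sum_nth_enumeration[OF vs(1), where f = "\<lambda>u. \<Sum>v\<in>_. (randic_weight G u v)\<^sup>2"] vs(2))
  also have "\<dots> \<le> real n / 2"
    using sum_randic_weight_squared_le[OF pos] connected_degree_sum_ge_4[OF assms(2) _ assms(6)]
      assms(4,5) by simp
  finally have F: "?F - 2 \<le> (real n - 4) / 2"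
    by simp
  have "randic_energy G \<le> 2 + sqrt ((real n - 2) * (?F - 2))"
    using symmetric_mat_energy_le[OF R transpose_randic_matrix ev] randic_energy_eq[OF vs] by simp
  also have "\<dots> \<le> 2 + sqrt ((real n - 2) * ((real n - 4) / 2))"
    using F assms(5) by (intro add_left_mono real_sqrt_le_mono mult_left_mono) auto
  \<comment> \<open>The product rule holds even where \<open>real n - 4\<close> is negative, because \<open>sqrt\<close> is extended to
    negative arguments as an odd function.\<close>
  also have "\<dots> = sqrt (real n - 2) * sqrt (real n - 4) * (1 / sqrt 2) + 2"
    by (simp add: real_sqrt_mult real_sqrt_divide)
  also have "1 / sqrt 2 = sqrt 2 / 2"
    by (simp add: field_simps)
  finally show ?thesis .
qed

end
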